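(* Let $A,B,C,D,E,F$ be rational numbers with $A^2+C^2+E^2=B^2+D^2+F^2$. Then for every rational number $x$, $$(Ax+1)^3+(Bx-1)^3+(Cx+1)^3+(Dx-1)^3+(Ex+1)^3+(Fx-1)^3$$ $$=(Ax-1)^3+(Bx+1)^3+(Cx-1)^3+(Dx+1)^3+(Ex-1)^3+(Fx+1)^3 .$$ Hence, taking $(A,C,E)=(2,10,21)$ and $(B,D,F)=(5,6,22)$, for every rational number $x$, $$(2x+1)^3+(5x-1)^3+(10x+1)^3+(6x-1)^3+(21x+1)^3+(22x-1)^3$$ $$=(2x-1)^3+(5x+1)^3+(10x-1)^3+(6x+1)^3+(21x-1)^3+(22x+1)^3 .$$
   Context: This gives parametric solutions of $a^3+b^3+c^3+d^3+e^3+f^3=p^3+q^3+r^3+s^3+t^3+u^3$; here $x$ is a free parameter. *)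

theory Defs
  imports Complex_Main
begin

end

theory Submission
  imports Defs
begin

text \<open>
  In \<open>(y + 1)^3 - (y - 1)^3\<close> the odd powers of \<open>y\<close> cancel, so the difference depends on \<open>y\<close> only
  through \<open>y^2\<close>. Moving each cube with \<open>- 1\<close> to the other side of the equation turns it into an
  equality of two sums of three such differences, at \<open>Ax, Cx, Ex\<close> and at \<open>Bx, Dx, Fx\<close>; these are
  \<open>6 (A^2 + C^2 + E^2) x^2 + 6\<close> and \<open>6 (B^2 + D^2 + F^2) x^2 + 6\<close>. The numerical identity is the
  case \<open>2^2 + 10^2 + 21^2 = 545 = 5^2 + 6^2 + 22^2\<close>.
\<close>

lemma cube_shift_diff:
  fixes y :: "'a::comm_ring_1"
  shows "(y + 1)^3 - (y - 1)^3 = 6 * y^2 + 2"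
  by (simp add: power2_eq_square power3_eq_cube algebra_simps)

lemma six_cubes_identity:
  fixes A B C D E F x :: "'a::comm_ring_1"
  assumes "A^2 + C^2 + E^2 = B^2 + D^2 + F^2"
  shows "(A*x + 1)^3 + (B*x - 1)^3 + (C*x + 1)^3 + (D*x - 1)^3 + (E*x + 1)^3 + (F*x - 1)^3
       = (A*x - 1)^3 + (B*x + 1)^3 + (C*x - 1)^3 + (D*x + 1)^3 + (E*x - 1)^3 + (F*x + 1)^3"
proof -
  have diff_sum: "((a*x + 1)^3 - (a*x - 1)^3) + ((b*x + 1)^3 - (b*x - 1)^3)
      + ((c*x + 1)^3 - (c*x - 1)^3) = 6 * (a^2 + b^2 + c^2) * x^2 + 6" for a b c :: 'a
    unfolding cube_shift_diff by (simp add: power_mult_distrib algebra_simps)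
  have "((A*x + 1)^3 - (A*x - 1)^3) + ((C*x + 1)^3 - (C*x - 1)^3) + ((E*x + 1)^3 - (E*x - 1)^3)
      = ((B*x + 1)^3 - (B*x - 1)^3) + ((D*x + 1)^3 - (D*x - 1)^3) + ((F*x + 1)^3 - (F*x - 1)^3)"
    unfolding diff_sum assms ..
  \<comment> \<open>Treating the cubes as atoms keeps the rearrangement linear.\<close>
  moreover have "a + b' + c + d' + e + f' = a' + b + c' + d + e' + f"
    if "(a - a') + (c - c') + (e - e') = (b - b') + (d - d') + (f - f')"
    for a a' b b' c c' d d' e e' f f' :: 'a
    using that by (simp add: algebra_simps)
  ultimately show ?thesis by blast
qed

theorem mainTheorem2:
  shows "(\<forall>(A::rat) (B::rat) (C::rat) (D::rat) (E::rat) (F::rat).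
            A^2 + C^2 + E^2 = B^2 + D^2 + F^2 \<longrightarrow>
            (\<forall>x::rat.
               (A*x + 1)^3 + (B*x - 1)^3 + (C*x + 1)^3 + (D*x - 1)^3 + (E*x + 1)^3 + (F*x - 1)^3
             = (A*x - 1)^3 + (B*x + 1)^3 + (C*x - 1)^3 + (D*x + 1)^3 + (E*x - 1)^3 + (F*x + 1)^3))
       \<and> (\<forall>x::rat.
               (2*x + 1)^3 + (5*x - 1)^3 + (10*x + 1)^3 + (6*x - 1)^3 + (21*x + 1)^3 + (22*x - 1)^3
             = (2*x - 1)^3 + (5*x + 1)^3 + (10*x - 1)^3 + (6*x + 1)^3 + (21*x - 1)^3 + (22*x + 1)^3)"
proof (intro conjI allI impI)
  fix A B C D E F x :: rat
  assume "A^2 + C^2 + E^2 = B^2 + D^2 + F^2"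
  then show "(A*x + 1)^3 + (B*x - 1)^3 + (C*x + 1)^3 + (D*x - 1)^3 + (E*x + 1)^3 + (F*x - 1)^3
       = (A*x - 1)^3 + (B*x + 1)^3 + (C*x - 1)^3 + (D*x + 1)^3 + (E*x - 1)^3 + (F*x + 1)^3"
    by (rule six_cubes_identity)
next
  fix x :: rat
  show "(2*x + 1)^3 + (5*x - 1)^3 + (10*x + 1)^3 + (6*x - 1)^3 + (21*x + 1)^3 + (22*x - 1)^3
      = (2*x - 1)^3 + (5*x + 1)^3 + (10*x - 1)^3 + (6*x + 1)^3 + (21*x - 1)^3 + (22*x + 1)^3"
    by (rule six_cubes_identity) simp
qed

end
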